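(* Let $\alpha\in\mathbb{R}\setminus\{0\}$, $\beta>0$, and put $n=1$ if $\alpha>0$ and $n=2$ if $\alpha<0$. Let $\mathbf{P}$ be the $n$-pseudoinverse of $\mathbf{X}\in\mathbb{T}_{\alpha\beta}^{p\times q}$. Then: 1. $\mathbf{P}$ is unique. 2. Let $\mathbf{U},\mathbf{V},\boldsymbol\Sigma_s,\boldsymbol\Sigma_d$ be the matrices of the SVD of $\mathbf{X}$ constructed in the context, where for $\alpha>0$ $$\boldsymbol\Sigma_s=\frac{\boldsymbol\Sigma_{s1}+\boldsymbol\Sigma_{d1}}{2}+\frac{\boldsymbol\Sigma_{s1}-\boldsymbol\Sigma_{d1}}{2\sqrt\alpha}\mathrm{i},\qquad \boldsymbol\Sigma_d=\frac{\boldsymbol\Sigma_{s2}+\boldsymbol\Sigma_{d2}}{2}+\frac{\boldsymbol\Sigma_{s2}-\boldsymbol\Sigma_{d2}}{2\sqrt\alpha}\mathrm{i}$$ with real matrices $\boldsymbol\Sigma_{s1},\boldsymbol\Sigma_{d1},\boldsymbol\Sigma_{s2},\boldsymbol\Sigma_{d2}$. Then the $n$-pseudoinverse of $\mathbf{X}$ is $$\mathbf{P}=\mathbf{V}\mathbf{Q}\mathbf{U}^{\mathtt{H}_{3-2n}^1},\qquad \mathbf{Q}=\mathbf{P}_s\mathrm{w}_1+\mathbf{P}_d\mathrm{w}_2,$$ where: for $\alpha<0$, $\mathbf{P}_s$ and $\mathbf{P}_d$ are the (Moore–Penrose) pseudoinverses of the real matrices $\boldsymbol\Sigma_s$ and $\boldsymbol\Sigma_d$;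 for $\alpha>0$, $$\mathbf{P}_s=\frac{\mathbf{P}_{s1}+\mathbf{P}_{d1}}{2}+\frac{\mathbf{P}_{s1}-\mathbf{P}_{d1}}{2\sqrt\alpha}\mathrm{i},\qquad \mathbf{P}_d=\frac{\mathbf{P}_{s2}+\mathbf{P}_{d2}}{2}+\frac{\mathbf{P}_{s2}-\mathbf{P}_{d2}}{2\sqrt\alpha}\mathrm{i},$$ with $\mathbf{P}_{\nu m}$ the (Moore–Penrose) pseudoinverse of the real matrix $\boldsymbol\Sigma_{\nu m}$, $\nu=s,d$, $m=1,2$.
   Context: $\mathbb{T}_{\alpha\beta}$ (the $(\alpha\beta)$-tessarines) is the commutative, associative real algebra with basis $1,\mathrm{i},\mathrm{j},\mathrm{k}$ and multiplication $\mathrm{i}^2=\alpha$, $\mathrm{j}^2=\beta$, $\mathrm{k}^2=\alpha\beta$, $\mathrm{i}\mathrm{j}=\mathrm{k}$, $\mathrm{i}\mathrm{k}=\alpha\mathrm{j}$, $\mathrm{j}\mathrm{k}=\beta\mathrm{i}$. $\mathbb{C}_\alpha=\{a+b\mathrm{i}\}$. Put $\mathrm{w}_1=\frac{\sqrt\beta+\mathrm{j}}{2\sqrt\beta}$, $\mathrm{w}_2=\frac{\sqrt\beta-\mathrm{j}}{2\sqrt\beta}$. A matrix $\mathbf{X}=\mathbf{A}+\mathbf{B}\mathrm{i}+\mathbf{C}\mathrm{j}+\mathbf{D}\mathrm{k}$ with real $\mathbf{A},\dots,\mathbf{D}$ is written $\mathbf{X}=\mathbf{X}_s\mathrm{w}_1+\mathbf{X}_d\mathrm{w}_2$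 with $\mathbf{X}_s=(\mathbf{A}+\mathbf{B}\mathrm{i})+\sqrt\beta(\mathbf{C}+\mathbf{D}\mathrm{i})$, $\mathbf{X}_d=(\mathbf{A}+\mathbf{B}\mathrm{i})-\sqrt\beta(\mathbf{C}+\mathbf{D}\mathrm{i})$. Hermitian transposes: $\mathbf{X}^{\mathtt{H}_{1}^{1}}=\mathbf{X}^{\mathtt T}$ and $\mathbf{X}^{\mathtt{H}_{-1}^{1}}=\mathbf{A}^{\mathtt T}-\mathbf{B}^{\mathtt T}\mathrm{i}+\mathbf{C}^{\mathtt T}\mathrm{j}-\mathbf{D}^{\mathtt T}\mathrm{k}$. An $n$-pseudoinverse of $\mathbf{X}\in\mathbb{T}_{\alpha\beta}^{p\times q}$ ($n=1$ for $\alpha>0$, $n=2$ for $\alpha<0$) is a matrix $\mathbf{P}$ over $\mathbb{T}_{\alpha\beta}$ with $\mathbf{X}\mathbf{P}\mathbf{X}=\mathbf{X}$, $\mathbf{P}\mathbf{X}\mathbf{P}=\mathbf{P}$, $(\mathbf{X}\mathbf{P})^{\mathtt{H}_{3-2n}^1}=\mathbf{X}\mathbf{P}$, $(\mathbf{P}\mathbf{X})^{\mathtt{H}_{3-2n}^1}=\mathbf{P}\mathbf{X}$. SVD construction. If $\alpha<0$: for $\nu=s,d$ write $\mathbf{X}_\nu=\mathbf{M}+\mathbf{N}\mathrm{i}$ ($\mathbf{M},\mathbf{N}$ real), let $\dot{\mathbf{U}}\boldsymbol\Sigma_\nu\dot{\mathbf{V}}^*$ be an SVD of the complex matrix $\mathbf{M}+\sqrt{|\alpha|}\,\mathbf{N}\epsilon$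 ($\epsilon^2=-1$), and let $\mathbf{U}_\nu,\mathbf{V}_\nu$ be obtained from $\dot{\mathbf{U}},\dot{\mathbf{V}}$ by replacing each entry $a+b\epsilon$ by $a+\frac{b}{\sqrt{|\alpha|}}\mathrm{i}$. If $\alpha>0$: write $\mathbf{X}_s=\mathbf{M}+\mathbf{N}\mathrm{i}$, let $\mathbf{M}+\sqrt\alpha\,\mathbf{N}=\mathbf{U}_{s1}\boldsymbol\Sigma_{s1}\mathbf{V}_{s1}^{\mathtt T}$ and $\mathbf{M}-\sqrt\alpha\,\mathbf{N}=\mathbf{U}_{d1}\boldsymbol\Sigma_{d1}\mathbf{V}_{d1}^{\mathtt T}$ be real SVDs (singular values in any order), and set $\mathbf{Y}_s=\frac{\mathbf{Y}_{s1}+\mathbf{Y}_{d1}}{2}+\frac{\mathbf{Y}_{s1}-\mathbf{Y}_{d1}}{2\sqrt\alpha}\mathrm{i}$ for $\mathbf{Y}=\mathbf{U},\boldsymbol\Sigma,\mathbf{V}$; do the same with $\mathbf{X}_d$, using SVDs indexed $s2$ and $d2$, to get $\mathbf{U}_d,\boldsymbol\Sigma_d,\mathbf{V}_d$. In both cases $\mathbf{U}=\frac{\mathbf{U}_s+\mathbf{U}_d}{2}+\frac{\mathbf{U}_s-\mathbf{U}_d}{2\sqrt\beta}\mathrm{j}$ and $\mathbf{V}=\frac{\mathbf{V}_s+\mathbf{V}_d}{2}+\frac{\mathbf{V}_s-\mathbf{V}_d}{2\sqrt\beta}\mathrm{j}$. *)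

theory Defs
  imports Complex_Main "Jordan_Normal_Form.Schur_Decomposition"
begin

section \<open>Tessarines\<close>

text \<open>The underlying vector space does not depend on the parameters \<open>\<alpha>, \<beta>\<close>; only the product does.
  So elements form one type, and the product takes \<open>\<alpha>\<close> and \<open>\<beta>\<close> as explicit arguments. The subalgebra
  \<open>\<complex>\<^sub>\<alpha>\<close> is represented by the elements whose last two components vanish.\<close>

datatype tess = Tess (t_re: real) (t_i: real) (t_j: real) (t_k: real)

instantiation tess :: real_vector
begin

definition zero_tess :: tess where
  "0 = Tess 0 0 0 0"

definition plus_tess :: "tess \<Rightarrow> tess \<Rightarrow> tess" where
  "x + y = Tess (t_re x + t_re y) (t_i x + t_i y) (t_j x + t_j y) (t_k x + t_k y)"

definition minus_tess :: "tess \<Rightarrow> tess \<Rightarrow> tess" where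
  "x - y = Tess (t_re x - t_re y) (t_i x - t_i y) (t_j x - t_j y) (t_k x - t_k y)"

definition uminus_tess :: "tess \<Rightarrow> tess" where
  "- x = Tess (- t_re x) (- t_i x) (- t_j x) (- t_k x)"

definition scaleR_tess :: "real \<Rightarrow> tess \<Rightarrow> tess" where
  "r *\<^sub>R x = Tess (r * t_re x) (r * t_i x) (r * t_j x) (r * t_k x)"

instance
  by standard
    (auto simp: zero_tess_def plus_tess_def minus_tess_def uminus_tess_def scaleR_tess_def
      algebra_simps)

end

definition tess_of_real :: "real \<Rightarrow> tess" where
  "tess_of_real r = Tess r 0 0 0"

definition tess_i :: tess where "tess_i = Tess 0 1 0 0"
definition tess_j :: tess where "tess_j = Tess 0 0 1 0"
definition tess_k :: tess where "tess_k = Tess 0 0 0 1"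

definition tess_mult :: "real \<Rightarrow> real \<Rightarrow> tess \<Rightarrow> tess \<Rightarrow> tess" where
  "tess_mult \<alpha> \<beta> x y = Tess
     (t_re x * t_re y + \<alpha> * (t_i x * t_i y) + \<beta> * (t_j x * t_j y) + \<alpha> * \<beta> * (t_k x * t_k y))
     (t_re x * t_i y + t_i x * t_re y + \<beta> * (t_j x * t_k y + t_k x * t_j y))
     (t_re x * t_j y + t_j x * t_re y + \<alpha> * (t_i x * t_k y + t_k x * t_i y))
     (t_re x * t_k y + t_k x * t_re y + t_i x * t_j y + t_j x * t_i y)"

lemma tess_mult_comm: "tess_mult \<alpha> \<beta> x y = tess_mult \<alpha> \<beta> y x"
  by (simp add: tess_mult_def algebra_simps)

lemma tess_mult_assoc:
  "tess_mult \<alpha> \<beta> (tess_mult \<alpha> \<beta> x y) z = tess_mult \<alpha> \<beta> x (tess_mult \<alpha> \<beta> y z)"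
  by (simp add: tess_mult_def algebra_simps)

lemma tess_mult_table:
  "tess_mult \<alpha> \<beta> tess_i tess_i = tess_of_real \<alpha>"
  "tess_mult \<alpha> \<beta> tess_j tess_j = tess_of_real \<beta>"
  "tess_mult \<alpha> \<beta> tess_k tess_k = tess_of_real (\<alpha> * \<beta>)"
  "tess_mult \<alpha> \<beta> tess_i tess_j = tess_k"
  "tess_mult \<alpha> \<beta> tess_i tess_k = \<alpha> *\<^sub>R tess_j"
  "tess_mult \<alpha> \<beta> tess_j tess_k = \<beta> *\<^sub>R tess_i"
  "tess_mult \<alpha> \<beta> (tess_of_real r) x = r *\<^sub>R x"
  by (simp_all add: tess_mult_def tess_i_def tess_j_def tess_k_def tess_of_real_def scaleR_tess_def)

definition tess_w1 :: "real \<Rightarrow> tess" where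
  "tess_w1 \<beta> = (1 / (2 * sqrt \<beta>)) *\<^sub>R (tess_of_real (sqrt \<beta>) + tess_j)"

definition tess_w2 :: "real \<Rightarrow> tess" where
  "tess_w2 \<beta> = (1 / (2 * sqrt \<beta>)) *\<^sub>R (tess_of_real (sqrt \<beta>) - tess_j)"

definition tess_s :: "real \<Rightarrow> tess \<Rightarrow> tess" where
  "tess_s \<beta> x = Tess (t_re x) (t_i x) 0 0 + sqrt \<beta> *\<^sub>R Tess (t_j x) (t_k x) 0 0"

definition tess_d :: "real \<Rightarrow> tess \<Rightarrow> tess" where
  "tess_d \<beta> x = Tess (t_re x) (t_i x) 0 0 - sqrt \<beta> *\<^sub>R Tess (t_j x) (t_k x) 0 0"

lemma tess_decomp:
  assumes "\<beta> > 0"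
  shows "x = tess_mult \<alpha> \<beta> (tess_s \<beta> x) (tess_w1 \<beta>) + tess_mult \<alpha> \<beta> (tess_d \<beta> x) (tess_w2 \<beta>)"
  using assms
  by (cases x) (simp add: tess_mult_def tess_w1_def tess_w2_def tess_s_def tess_d_def tess_j_def
      tess_of_real_def plus_tess_def minus_tess_def scaleR_tess_def field_simps)


section \<open>Matrices over the tessarines\<close>

definition tess_mat_mult :: "real \<Rightarrow> real \<Rightarrow> tess mat \<Rightarrow> tess mat \<Rightarrow> tess mat" where
  "tess_mat_mult \<alpha> \<beta> A B = mat (dim_row A) (dim_col B)
     (\<lambda>(i, j). \<Sum>k<dim_row B. tess_mult \<alpha> \<beta> (A $$ (i, k)) (B $$ (k, j)))"

definition tess_cnj_i :: "tess \<Rightarrow> tess" where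
  "tess_cnj_i x = Tess (t_re x) (- t_i x) (t_j x) (- t_k x)"

text \<open>\<open>herm m X\<close> is the Hermitian transpose with superscript \<open>1\<close> and subscript \<open>m\<close>; only the
  subscripts \<open>m = 1\<close> and \<open>m = -1\<close> are meaningful.\<close>

definition herm :: "int \<Rightarrow> tess mat \<Rightarrow> tess mat" where
  "herm m X = (if m = 1 then transpose_mat X else transpose_mat (map_mat tess_cnj_i X))"

definition is_npinv :: "real \<Rightarrow> real \<Rightarrow> nat \<Rightarrow> tess mat \<Rightarrow> tess mat \<Rightarrow> bool" where
  "is_npinv \<alpha> \<beta> n X P \<longleftrightarrow>
     P \<in> carrier_mat (dim_col X) (dim_row X) \<and>
     tess_mat_mult \<alpha> \<beta> (tess_mat_mult \<alpha> \<beta> X P) X = X \<and>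
     tess_mat_mult \<alpha> \<beta> (tess_mat_mult \<alpha> \<beta> P X) P = P \<and>
     herm (3 - 2 * int n) (tess_mat_mult \<alpha> \<beta> X P) = tess_mat_mult \<alpha> \<beta> X P \<and>
     herm (3 - 2 * int n) (tess_mat_mult \<alpha> \<beta> P X) = tess_mat_mult \<alpha> \<beta> P X"


section \<open>Singular value decompositions and pseudoinverses over the reals and the complex numbers\<close>

text \<open>On the reals \<open>conjugate\<close> is the identity, so there \<open>mat_adjoint\<close> is the transpose and unitary
  means orthogonal. The singular values may appear in any order.\<close>

definition is_unitary :: "'a::conjugatable_field mat \<Rightarrow> bool" where
  "is_unitary U \<longleftrightarrow> square_mat U \<and>
     mat_adjoint U * U = 1\<^sub>m (dim_row U) \<and> U * mat_adjoint U = 1\<^sub>m (dim_row U)"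

definition is_svd ::
  "'a::{conjugatable_field, real_algebra_1} mat \<Rightarrow> 'a mat \<Rightarrow> real mat \<Rightarrow> 'a mat \<Rightarrow> bool" where
  "is_svd A U S V \<longleftrightarrow>
     U \<in> carrier_mat (dim_row A) (dim_row A) \<and> is_unitary U \<and>
     V \<in> carrier_mat (dim_col A) (dim_col A) \<and> is_unitary V \<and>
     S \<in> carrier_mat (dim_row A) (dim_col A) \<and> diagonal_mat S \<and>
     (\<forall>i < min (dim_row A) (dim_col A). S $$ (i, i) \<ge> 0) \<and>
     A = U * map_mat of_real S * mat_adjoint V"

definition is_mp_inverse :: "real mat \<Rightarrow> real mat \<Rightarrow> bool" where
  "is_mp_inverse A P \<longleftrightarrow>
     P \<in> carrier_mat (dim_col A) (dim_row A) \<and>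
     A * P * A = A \<and> P * A * P = P \<and>
     transpose_mat (A * P) = A * P \<and> transpose_mat (P * A) = P * A"

definition mp_inverse :: "real mat \<Rightarrow> real mat" where
  "mp_inverse A = (THE P. is_mp_inverse A P)"


section \<open>Passing between matrices over the tessarines and real or complex matrices\<close>

text \<open>For \<open>\<alpha> < 0\<close>, the following two maps are mutually inverse isomorphisms between \<open>\<complex>\<^sub>\<alpha>\<close> and the
  complex numbers.\<close>

definition to_cpx :: "real \<Rightarrow> tess \<Rightarrow> complex" where
  "to_cpx \<alpha> x = Complex (t_re x) (sqrt \<bar>\<alpha>\<bar> * t_i x)"

definition of_cpx :: "real \<Rightarrow> complex \<Rightarrow> tess" where
  "of_cpx \<alpha> z = tess_of_real (Re z) + (Im z / sqrt \<bar>\<alpha>\<bar>) *\<^sub>R tess_i"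

text \<open>For \<open>\<alpha> > 0\<close>, \<open>real_s\<close> and \<open>real_d\<close> are the two homomorphisms from \<open>\<complex>\<^sub>\<alpha>\<close> to the reals, and
  \<open>join_i\<close> recovers a matrix over \<open>\<complex>\<^sub>\<alpha>\<close> from its two images.\<close>

definition real_s :: "real \<Rightarrow> tess \<Rightarrow> real" where
  "real_s \<alpha> x = t_re x + sqrt \<alpha> * t_i x"

definition real_d :: "real \<Rightarrow> tess \<Rightarrow> real" where
  "real_d \<alpha> x = t_re x - sqrt \<alpha> * t_i x"

definition join_i :: "real \<Rightarrow> real mat \<Rightarrow> real mat \<Rightarrow> tess mat" where
  "join_i \<alpha> Y Z = map_mat (\<lambda>r. tess_of_real (r / 2)) (Y + Z)
     + map_mat (\<lambda>r. (r / (2 * sqrt \<alpha>)) *\<^sub>R tess_i) (Y - Z)"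

definition join_j :: "real \<Rightarrow> real \<Rightarrow> tess mat \<Rightarrow> tess mat \<Rightarrow> tess mat" where
  "join_j \<alpha> \<beta> Y Z = map_mat (\<lambda>y. (1 / 2) *\<^sub>R y) (Y + Z)
     + map_mat (\<lambda>y. tess_mult \<alpha> \<beta> ((1 / (2 * sqrt \<beta>)) *\<^sub>R y) tess_j) (Y - Z)"

definition join_w :: "real \<Rightarrow> real \<Rightarrow> tess mat \<Rightarrow> tess mat \<Rightarrow> tess mat" where
  "join_w \<alpha> \<beta> Y Z = map_mat (\<lambda>y. tess_mult \<alpha> \<beta> y (tess_w1 \<beta>)) Y
     + map_mat (\<lambda>z. tess_mult \<alpha> \<beta> z (tess_w2 \<beta>)) Z"

end

(* For alpha < 0 the algebra is isomorphic to C x C, for alpha > 0 to R x R x R x R, and the Hermitian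
   transpose of the statement becomes the adjoint in each factor. So the n-pseudoinverses of X are exactly
   the matrices that project to the Moore-Penrose inverses of the components of X: existence, uniqueness
   and the formula A^+ = V S^+ U^* for A = U S V^* can be checked over R and C. Existence over a field with
   a positive conjugation needs no singular value decomposition: Gauss-Jordan elimination yields a
   generalized inverse of A^* A, and of A A^*, from which A^+ is assembled. *)
theory Submission
  imports Defs
begin

section \<open>Moore-Penrose inverses over a field with conjugation\<close>

text \<open>Associativity under conditions on dimensions instead of carriers: without extra variables in
  the premises it can serve as a simplification rule.\<close>

lemma mult_mat_assoc_dim:
  fixes A :: "'a::semiring_0 mat"
  assumes "dim_col A = dim_row B" "dim_col B = dim_row C"
  shows "A * B * C = A * (B * C)"
  using assms by (intro assoc_mult_mat) auto

lemma mat_adjoint_conv: "mat_adjoint A = transpose_mat (map_mat conjugate A)"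
  by (intro eq_matI) (auto simp: mat_adjoint_def mat_of_rows_def)

lemma dim_mat_adjoint [simp]:
  "dim_row (mat_adjoint A) = dim_col A" "dim_col (mat_adjoint A) = dim_row A"
  by (simp_all add: mat_adjoint_conv)

lemma mat_adjoint_adjoint [simp]: "mat_adjoint (mat_adjoint A) = A"
  by (intro eq_matI) (auto simp: mat_adjoint_conv)

lemma mat_adjoint_mult:
  assumes "dim_col A = dim_row B"
  shows "mat_adjoint (A * B) = mat_adjoint B * mat_adjoint A"
  using assms
  by (intro eq_matI)
    (auto simp: mat_adjoint_conv scalar_prod_def sum_conjugate conjugate_dist_mul mult.commute)

text \<open>Generalizes \<open>is_mp_inverse\<close> beyond real matrices, since the components of X
  are complex for alpha < 0.\<close>

definition moore_penrose :: "'a::conjugatable_field mat \<Rightarrow> 'a mat \<Rightarrow> bool" where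
  "moore_penrose A P \<longleftrightarrow>
     P \<in> carrier_mat (dim_col A) (dim_row A) \<and> A * P * A = A \<and> P * A * P = P \<and>
     mat_adjoint (A * P) = A * P \<and> mat_adjoint (P * A) = P * A"

lemma is_mp_inverse_iff: "is_mp_inverse A P \<longleftrightarrow> moore_penrose A P"
proof -
  have "mat_adjoint M = transpose_mat M" for M :: "real mat"
    by (intro eq_matI) (auto simp: mat_adjoint_conv)
  then show ?thesis
    by (simp add: is_mp_inverse_def moore_penrose_def)
qed

text \<open>From A Q A = A follows A P = (A Q)(A P); taking adjoints swaps the factors and gives A P
  = A P A Q = A Q. In the same way P A = Q A, so P = P A P = Q A Q = Q.\<close>

lemma moore_penrose_unique:
  assumes "moore_penrose A P" "moore_penrose A Q"
  shows "P = Q"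
proof -
  note P = assms(1)[unfolded moore_penrose_def] and Q = assms(2)[unfolded moore_penrose_def]
  have d [simp]: "dim_row P = dim_col A" "dim_col P = dim_row A"
      "dim_row Q = dim_col A" "dim_col Q = dim_row A"
    using P Q by auto
  have "A * P = A * Q * (A * P)"
    using Q by (metis d mult_mat_assoc_dim index_mult_mat(2,3))
  then have "mat_adjoint (A * P) = mat_adjoint (A * P) * mat_adjoint (A * Q)"
    by (metis d mat_adjoint_mult index_mult_mat(2,3))
  then have "A * P = A * P * (A * Q)"
    using P Q by simp
  also have "\<dots> = A * P * A * Q"
    by (simp add: mult_mat_assoc_dim)
  finally have left: "A * P = A * Q"
    using P by simp
  have "P * A * (Q * A) = P * (A * Q * A)"
    by (simp add: mult_mat_assoc_dim)
  then have "P * A = P * A * (Q * A)"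
    using Q by simp
  then have "mat_adjoint (P * A) = mat_adjoint (Q * A) * mat_adjoint (P * A)"
    by (metis d mat_adjoint_mult index_mult_mat(2,3))
  then have "P * A = Q * A * (P * A)"
    using P Q by simp
  also have "\<dots> = Q * (A * P * A)"
    by (simp add: mult_mat_assoc_dim)
  finally have right: "P * A = Q * A"
    using P by simp
  have "P = P * A * P"
    using P by simp
  also have "\<dots> = Q * (A * P)"
    by (simp add: right mult_mat_assoc_dim)
  also have "\<dots> = Q * A * Q"
    by (simp add: left mult_mat_assoc_dim)
  finally show ?thesis
    using Q by simp
qed

section \<open>Existence of the Moore-Penrose inverse\<close>

lemma generalized_inverse_exists:
  fixes A :: "'a::field mat"
  shows "\<exists>G \<in> carrier_mat (dim_col A) (dim_row A). A * G * A = A"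
proof -
  let ?m = "dim_row A" and ?n = "dim_col A"
  define C where "C = gauss_jordan_single A"
  have A: "A \<in> carrier_mat ?m ?n"
    by simp
  note gj = gauss_jordan_single[OF A C_def[symmetric]]
  from gj(4) obtain P Q where C: "C = P * A" and P: "P \<in> carrier_mat ?m ?m"
    and Q: "Q \<in> carrier_mat ?m ?m" and QP: "Q * P = 1\<^sub>m ?m"
    by blast
  have dC: "dim_row C = ?m" "dim_col C = ?n"
    using gj(2) by auto
  from gj(3) obtain f where "pivot_fun C f ?n"
    unfolding row_echelon_form_def dC by blast
  note f = pivot_funD[OF dC(1) this]
  \<comment> \<open>The columns of \<open>C\<close> at the pivots are unit vectors, so selecting them inverts \<open>C\<close> on its range.\<close>
  define E where "E = mat ?n ?m (\<lambda>(j, i). if f i = j then 1 else 0 :: 'a)"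
  have E: "E \<in> carrier_mat ?n ?m"
    by (simp add: E_def)
  \<comment> \<open>A pivot position \<open>f k = ?n\<close> marks a zero row of \<open>C\<close>.
    So \<open>C * E\<close> is the diagonal projection onto the nonzero rows, and it fixes
    \<open>C\<close>.\<close>
  have CE: "(C * E) $$ (i, k) = (if i = k \<and> f k < ?n then 1 else 0)"
    if "i < ?m" "k < ?m" for i k
  proof -
    have "(C * E) $$ (i, k) = (\<Sum>j\<in>{0..<?n}. C $$ (i, j) * (if f k = j then 1 else 0))"
      using that dC by (simp add: E_def scalar_prod_def)
    also have "\<dots> = (\<Sum>j\<in>{0..<?n}. if f k = j then C $$ (i, j) else 0)"
      by (intro sum.cong) auto
    also have "\<dots> = (if f k < ?n then C $$ (i, f k) else 0)"
      by (simp add: sum.delta')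
    finally show ?thesis
      using f that by auto
  qed
  have "C * E * C = C"
  proof (intro eq_matI)
    fix i j
    assume ij: "i < dim_row C" "j < dim_col C"
    have "(C * E * C) $$ (i, j) = (\<Sum>k\<in>{0..<?m}. (C * E) $$ (i, k) * C $$ (k, j))"
      using ij dC by (simp add: scalar_prod_def E_def)
    also have "\<dots> = (\<Sum>k\<in>{0..<?m}. if i = k then if f k < ?n then C $$ (k, j) else 0 else 0)"
      using ij dC by (intro sum.cong) (auto simp: CE)
    also have "\<dots> = (if f i < ?n then C $$ (i, j) else 0)"
      using ij dC by (simp add: sum.delta')
    also have "\<dots> = C $$ (i, j)"
      using ij dC f(2)[of i j] f(1)[of i] by auto
    finally show "(C * E * C) $$ (i, j) = C $$ (i, j)" .
  qed (simp_all add: dC)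
  \<comment> \<open>Multiplying by \<open>Q\<close>, which inverts \<open>P\<close>, undoes the row
    operations and turns C E C = C into A (E P) A = A.\<close>
  then have "Q * (P * A * E * (P * A)) = Q * (P * A)"
    by (simp add: C)
  then have "Q * P * A * (E * P) * A = Q * P * A"
    using P Q E by (simp add: mult_mat_assoc_dim)
  then have "A * (E * P) * A = A"
    by (simp add: QP)
  with P E show ?thesis
    by (intro bexI[of _ "E * P"]) auto
qed

text \<open>A diagonal entry of the product is a sum of terms x * \<open>conjugate\<close> x.
  Positivity of the conjugation enters here: these terms are nonnegative, so a zero sum makes each
  of them zero.\<close>

lemma mat_adjoint_mult_self_eq_0:
  fixes M :: "'a::conjugatable_ordered_field mat"
  assumes "mat_adjoint M * M = 0\<^sub>m (dim_col M) (dim_col M)"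
  shows "M = 0\<^sub>m (dim_row M) (dim_col M)"
proof (intro eq_matI)
  fix i j
  assume "i < dim_row (0\<^sub>m (dim_row M) (dim_col M) :: 'a mat)"
    "j < dim_col (0\<^sub>m (dim_row M) (dim_col M) :: 'a mat)"
  then have ij: "i < dim_row M" "j < dim_col M"
    by auto
  have "(\<Sum>k\<in>{0..<dim_row M}. M $$ (k, j) * conjugate (M $$ (k, j))) = (mat_adjoint M * M) $$ (j, j)"
    using ij by (simp add: mat_adjoint_conv scalar_prod_def mult.commute)
  also have "\<dots> = 0"
    using ij assms by simp
  finally have "M $$ (i, j) * conjugate (M $$ (i, j)) = 0"
    using ij by (subst (asm) sum_nonneg_eq_0_iff) (auto simp: conjugate_square_positive)
  then show "M $$ (i, j) = 0\<^sub>m (dim_row M) (dim_col M) $$ (i, j)"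
    using ij by simp
qed auto

text \<open>The difference M = A B - A C is annihilated by the adjoint of A. Hence the adjoint of M
  annihilates A, therefore also M itself, and M = 0 by positivity.\<close>

lemma mat_adjoint_mult_cancel:
  fixes A :: "'a::conjugatable_ordered_field mat"
  assumes [simp]: "dim_row B = dim_col A" "dim_row C = dim_col A" "dim_col C = dim_col B"
    and eq: "mat_adjoint A * (A * B) = mat_adjoint A * (A * C)"
  shows "A * B = A * C"
proof -
  define M where "M = A * B - A * C"
  have [simp]: "dim_row M = dim_row A" "dim_col M = dim_col B"
    by (auto simp: M_def)
  have "mat_adjoint A * M = mat_adjoint A * (A * B) - mat_adjoint A * (A * C)"
    unfolding M_def by (intro mult_minus_distrib_mat) auto
  also have "\<dots> = 0\<^sub>m (dim_col A) (dim_col B)"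
    unfolding eq by (intro eq_matI) auto
  finally have AM: "mat_adjoint A * M = 0\<^sub>m (dim_col A) (dim_col B)" .
  have "mat_adjoint M * A = mat_adjoint (mat_adjoint A * M)"
    by (simp add: mat_adjoint_mult)
  also have "\<dots> = 0\<^sub>m (dim_col B) (dim_col A)"
    unfolding AM by (intro eq_matI) (auto simp: mat_adjoint_conv)
  finally have MA: "mat_adjoint M * A = 0\<^sub>m (dim_col B) (dim_col A)" .
  have "mat_adjoint M * M = mat_adjoint M * (A * B) - mat_adjoint M * (A * C)"
    \<comment> \<open>Only the right factor is expanded; the left one keeps the form that
      \<open>MA\<close> needs.\<close>
    unfolding M_def[THEN arg_cong[where f = "\<lambda>x. mat_adjoint M * x"]]
    by (intro mult_minus_distrib_mat) auto
  also have "\<dots> = mat_adjoint M * A * B - mat_adjoint M * A * C"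
    by (simp add: mult_mat_assoc_dim)
  also have "\<dots> = 0\<^sub>m (dim_col M) (dim_col M)"
    unfolding MA by (intro eq_matI) auto
  finally have "M = 0\<^sub>m (dim_row A) (dim_col B)"
    using mat_adjoint_mult_self_eq_0[of M] by simp
  then have "M $$ (i, j) = 0" if "i < dim_row A" "j < dim_col B" for i j
    using that by simp
  then show ?thesis
    by (intro eq_matI) (auto simp: M_def)
qed

text \<open>With \<open>G\<close> a generalized inverse of \<open>A\<^sup>* A\<close>, the matrix \<open>L = G A\<^sup>*\<close> satisfies the first and third
  Penrose equations: cancelling \<open>A\<^sup>*\<close> in \<open>A\<^sup>* A G A\<^sup>* A = A\<^sup>* A\<close> gives \<open>A L A = A\<close>, and then
  \<open>A L (A L)\<^sup>* = A L A G\<^sup>* A\<^sup>* = (A L)\<^sup>*\<close>.\<close>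

lemma least_squares_inverse_exists:
  fixes A :: "'a::conjugatable_ordered_field mat"
  shows "\<exists>L \<in> carrier_mat (dim_col A) (dim_row A). A * L * A = A \<and> mat_adjoint (A * L) = A * L"
proof -
  let ?H = "mat_adjoint A * A"
  obtain G where G: "G \<in> carrier_mat (dim_col A) (dim_col A)" and H: "?H * G * ?H = ?H"
    using generalized_inverse_exists[of ?H] by auto
  have [simp]: "dim_row G = dim_col A" "dim_col G = dim_col A"
    using G by auto
  define L where "L = G * mat_adjoint A"
  have [simp]: "dim_row L = dim_col A" "dim_col L = dim_row A"
    by (auto simp: L_def)
  have "?H * G * ?H = mat_adjoint A * (A * (L * A))"
    by (simp add: L_def mult_mat_assoc_dim)
  \<comment> \<open>The identity matrix gives the right-hand side the shape A C required by the
    cancellation lemma.\<close>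
  then have "mat_adjoint A * (A * (L * A)) = mat_adjoint A * (A * 1\<^sub>m (dim_col A))"
    using H by simp
  then have "A * (L * A) = A * 1\<^sub>m (dim_col A)"
    by (rule mat_adjoint_mult_cancel[rotated 3]) simp_all
  then have ALA: "A * L * A = A"
    by (simp add: mult_mat_assoc_dim)
  have adj: "mat_adjoint (A * L) = A * (mat_adjoint G * mat_adjoint A)"
    by (simp add: L_def mat_adjoint_mult mult_mat_assoc_dim)
  have "A * L * mat_adjoint (A * L) = A * L * A * (mat_adjoint G * mat_adjoint A)"
    unfolding adj by (simp add: mult_mat_assoc_dim)
  then have self: "A * L * mat_adjoint (A * L) = mat_adjoint (A * L)"
    by (simp add: ALA adj)
  \<comment> \<open>By \<open>self\<close>, the adjoint of A L has the form Z Z^H with Z = A L,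
    hence is self-adjoint.\<close>
  have "mat_adjoint (A * L) = mat_adjoint (mat_adjoint (A * L))"
    by (subst (1 2) self[symmetric]) (simp add: mat_adjoint_mult)
  then have "mat_adjoint (A * L) = A * L"
    by simp
  with ALA show ?thesis
    by (intro bexI[of _ L]) auto
qed

text \<open>L satisfies the first and third Penrose equations. Applying the same result to the
  adjoint of A and taking adjoints yields R with the first and fourth. Then P = R A L has A P = A L
  and P A = R A, and so satisfies all four.\<close>

lemma moore_penrose_exists:
  fixes A :: "'a::conjugatable_ordered_field mat"
  shows "\<exists>P. moore_penrose A P"
proof -
  obtain L where "L \<in> carrier_mat (dim_col A) (dim_row A)"
    and L: "A * L * A = A" "mat_adjoint (A * L) = A * L"
    using least_squares_inverse_exists by blast
  moreover obtain M where "M \<in> carrier_mat (dim_row A) (dim_col A)"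
    and M: "mat_adjoint A * M * mat_adjoint A = mat_adjoint A"
      "mat_adjoint (mat_adjoint A * M) = mat_adjoint A * M"
    using least_squares_inverse_exists[of "mat_adjoint A"] by auto
  ultimately have [simp]: "dim_row L = dim_col A" "dim_col L = dim_row A"
      "dim_row M = dim_row A" "dim_col M = dim_col A"
    by auto
  define R where "R = mat_adjoint M"
  have [simp]: "dim_row R = dim_col A" "dim_col R = dim_row A"
    by (auto simp: R_def)
  have "mat_adjoint (mat_adjoint A * M * mat_adjoint A) = A"
    by (simp add: M)
  then have ARA: "A * R * A = A"
    by (simp add: mat_adjoint_mult R_def mult_mat_assoc_dim)
  have RA: "mat_adjoint (R * A) = R * A"
    using M(2) by (simp add: mat_adjoint_mult R_def)
  define P where "P = R * A * L"
  have [simp]: "dim_row P = dim_col A" "dim_col P = dim_row A"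
    by (auto simp: P_def)
  have "A * P = A * R * A * L" "P * A = R * (A * L * A)"
    by (simp_all add: P_def mult_mat_assoc_dim)
  then have AP: "A * P = A * L" and PA: "P * A = R * A"
    by (simp_all add: ARA L)
  have "P * A * P = R * (A * P)"
    by (simp add: PA mult_mat_assoc_dim)
  then have "P * A * P = P"
    unfolding AP by (simp add: P_def mult_mat_assoc_dim)
  then have "moore_penrose A P"
    unfolding moore_penrose_def by (auto simp: AP PA L RA)
  then show ?thesis ..
qed

text \<open>Existence and uniqueness make the definite description in \<open>mp_inverse\<close>
  meaningful.\<close>

lemma moore_penrose_mp_inverse: "moore_penrose A (mp_inverse A)"
proof -
  have "\<exists>!P. is_mp_inverse A P"
    unfolding is_mp_inverse_iff using moore_penrose_exists moore_penrose_unique by blast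
  then show ?thesis
    unfolding is_mp_inverse_iff[symmetric] mp_inverse_def by (rule theI')
qed

section \<open>The Moore-Penrose inverse from a singular value decomposition\<close>

lemma map_mat_of_real_mult:
  assumes "dim_col A = dim_row B"
  shows "map_mat of_real (A * B) =
    (map_mat of_real A * map_mat of_real B :: 'a::{real_algebra_1, comm_ring_1} mat)"
  using assms by (intro eq_matI) (auto simp: scalar_prod_def)

text \<open>Singular values are real while the unitary factors may be complex. By
  \<open>conj\<close> the embedding of the reals commutes with adjoints, so the Penrose equations
  carry over.\<close>

lemma moore_penrose_of_real:
  assumes "moore_penrose A P"
    and conj: "\<And>r. conjugate (of_real r :: 'a::{conjugatable_field, real_algebra_1}) = of_real r"
  shows "moore_penrose (map_mat of_real A :: 'a mat) (map_mat of_real P)"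
proof -
  note P = assms(1)[unfolded moore_penrose_def]
  have [simp]: "dim_row P = dim_col A" "dim_col P = dim_row A"
    using P by auto
  have adj: "mat_adjoint (map_mat of_real M) = (map_mat of_real (mat_adjoint M) :: 'a mat)"
    for M :: "real mat"
    by (intro eq_matI) (auto simp: mat_adjoint_conv conj)
  show ?thesis
    using P unfolding moore_penrose_def
    by (auto simp: map_mat_of_real_mult[symmetric] adj)
qed

text \<open>The inner unitary factors cancel in every product, which leaves the Penrose equations of
  S and T between outer unitary factors.\<close>

lemma moore_penrose_unitary_mult:
  fixes S :: "'a::conjugatable_field mat"
  assumes T: "moore_penrose S T"
    and "is_unitary U" "is_unitary V"
    and dU: "dim_row U = dim_row S" and dV: "dim_row V = dim_col S"
  shows "moore_penrose (U * S * mat_adjoint V) (V * T * mat_adjoint U)"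
proof -
  note T = T[unfolded moore_penrose_def]
  have [simp]: "dim_row T = dim_col S" "dim_col T = dim_row S"
    using T by auto
  have [simp]: "dim_row U = dim_row S" "dim_col U = dim_row S"
      "dim_row V = dim_col S" "dim_col V = dim_col S"
    using assms by (auto simp: is_unitary_def)
  have UU: "mat_adjoint U * U = 1\<^sub>m (dim_row S)" and VV: "mat_adjoint V * V = 1\<^sub>m (dim_col S)"
    using assms by (auto simp: is_unitary_def)
  \<comment> \<open>Cancellation in right-nested form, so that it works as a rewrite rule together
    with \<open>mult_mat_assoc_dim\<close>.\<close>
  have U: "mat_adjoint U * (U * Z) = Z" if "dim_row Z = dim_row S" for Z
    using that by (simp add: mult_mat_assoc_dim[symmetric] UU)
  have V: "mat_adjoint V * (V * Z) = Z" if "dim_row Z = dim_col S" for Z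
    using that by (simp add: mult_mat_assoc_dim[symmetric] VV)
  let ?A = "U * S * mat_adjoint V" and ?P = "V * T * mat_adjoint U"
  have AP: "?A * ?P = U * (S * T) * mat_adjoint U"
    by (simp add: mult_mat_assoc_dim V)
  have PA: "?P * ?A = V * (T * S) * mat_adjoint V"
    by (simp add: mult_mat_assoc_dim U)
  have "?A * ?P * ?A = U * (S * T * S) * mat_adjoint V"
    unfolding AP by (simp add: mult_mat_assoc_dim U)
  moreover have "?P * ?A * ?P = V * (T * S * T) * mat_adjoint U"
    unfolding PA by (simp add: mult_mat_assoc_dim V)
  moreover have "mat_adjoint (U * (S * T) * mat_adjoint U) = U * mat_adjoint (S * T) * mat_adjoint U"
    by (subst mat_adjoint_mult, simp, subst mat_adjoint_mult, simp, simp add: mult_mat_assoc_dim)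
  moreover have "mat_adjoint (V * (T * S) * mat_adjoint V) = V * mat_adjoint (T * S) * mat_adjoint V"
    by (subst mat_adjoint_mult, simp, subst mat_adjoint_mult, simp, simp add: mult_mat_assoc_dim)
  ultimately show ?thesis
    unfolding moore_penrose_def AP PA using T by auto
qed

lemma moore_penrose_svd:
  fixes A :: "'a::{conjugatable_field, real_algebra_1} mat"
  assumes svd: "is_svd A U S V"
    and conj: "\<And>r. conjugate (of_real r :: 'a) = of_real r"
  shows "moore_penrose A (V * map_mat of_real (mp_inverse S) * mat_adjoint U)"
proof -
  have A: "A = U * map_mat of_real S * mat_adjoint V"
    and U: "is_unitary U" and V: "is_unitary V"
    and d: "dim_row U = dim_row S" "dim_row V = dim_col S"
    using svd by (simp_all only: is_svd_def carrier_mat_def mem_Collect_eq)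
  have "moore_penrose (map_mat of_real S :: 'a mat) (map_mat of_real (mp_inverse S))"
    by (rule moore_penrose_of_real[OF moore_penrose_mp_inverse conj])
  then show ?thesis
    unfolding A using U V d by (intro moore_penrose_unitary_mult) simp_all
qed

section \<open>Splitting the tessarines into fields\<close>

text \<open>An isomorphism onto a product of copies of one field with positive conjugation, one copy
  for each index in \<open>'i\<close>, so that a single argument serves both signs of alpha.
  \<open>hom_herm\<close> ties n to the sign: it picks the Hermitian transpose that becomes the
  adjoint in every factor.\<close>

locale tess_splitting =
  fixes \<alpha> \<beta> :: real and n :: nat
    and \<phi> :: "'i \<Rightarrow> tess \<Rightarrow> 'a::{conjugatable_ordered_field, real_algebra_1}"
  assumes conjugate_of_real: "\<And>r. conjugate (of_real r :: 'a) = of_real r"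
    and hom_zero: "\<phi> i 0 = 0"
    and hom_add: "\<phi> i (x + y) = \<phi> i x + \<phi> i y"
    and hom_mult: "\<phi> i (tess_mult \<alpha> \<beta> x y) = \<phi> i x * \<phi> i y"
    and hom_herm: "map_mat (\<phi> i) (herm (3 - 2 * int n) M) = mat_adjoint (map_mat (\<phi> i) M)"
    and joint_inj: "(\<And>i. \<phi> i x = \<phi> i y) \<Longrightarrow> x = y"
    and joint_surj: "\<exists>x. \<forall>i. \<phi> i x = f i"
begin

lemma map_tess_mat_mult:
  assumes "dim_col A = dim_row B"
  shows "map_mat (\<phi> i) (tess_mat_mult \<alpha> \<beta> A B) = map_mat (\<phi> i) A * map_mat (\<phi> i) B"
proof -
  have sum: "\<phi> i (sum g K) = (\<Sum>k\<in>K. \<phi> i (g k))" if "finite K" for g and K :: "nat set"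
    using that by induction (auto simp: hom_zero hom_add)
  show ?thesis
    using assms
    by (intro eq_matI) (auto simp: tess_mat_mult_def sum hom_mult scalar_prod_def lessThan_atLeast0)
qed

lemma mat_eq_iff:
  assumes "dim_row A = dim_row B" "dim_col A = dim_col B"
  shows "A = B \<longleftrightarrow> (\<forall>i. map_mat (\<phi> i) A = map_mat (\<phi> i) B)"
proof
  assume *: "\<forall>i. map_mat (\<phi> i) A = map_mat (\<phi> i) B"
  show "A = B"
  proof (intro eq_matI joint_inj)
    fix r c i
    assume "r < dim_row B" "c < dim_col B"
    then show "\<phi> i (A $$ (r, c)) = \<phi> i (B $$ (r, c))"
      using assms arg_cong[OF *[rule_format, of i], of "\<lambda>M. M $$ (r, c)"] by simp
  qed (use assms in auto)
qed simp

text \<open>Each defining equation holds exactly if all its images under the projections hold, and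
  these images are the Penrose equations of the components.\<close>

lemma is_npinv_iff:
  assumes P: "P \<in> carrier_mat (dim_col X) (dim_row X)"
  shows "is_npinv \<alpha> \<beta> n X P \<longleftrightarrow> (\<forall>i. moore_penrose (map_mat (\<phi> i) X) (map_mat (\<phi> i) P))"
proof -
  have [simp]: "dim_row P = dim_col X" "dim_col P = dim_row X"
    using P by auto
  have [simp]: "dim_row (tess_mat_mult \<alpha> \<beta> A B) = dim_row A"
    "dim_col (tess_mat_mult \<alpha> \<beta> A B) = dim_col B" for A B
    by (auto simp: tess_mat_mult_def)
  have [simp]: "dim_row (herm m A) = dim_col A" "dim_col (herm m A) = dim_row A" for m A
    by (auto simp: herm_def)
  show ?thesis
    unfolding is_npinv_def moore_penrose_def
    by (auto simp: mat_eq_iff map_tess_mat_mult hom_herm)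
qed

text \<open>Existence: the Moore-Penrose inverses of the components are glued entry by entry with
  \<open>joint_surj\<close>. Uniqueness: it holds in every component.\<close>

lemma npinv_ex1: "\<exists>!P. is_npinv \<alpha> \<beta> n X P"
proof (rule ex_ex1I)
  have "\<forall>i. \<exists>Q. moore_penrose (map_mat (\<phi> i) X) Q"
    using moore_penrose_exists by blast
  then obtain Q where Q: "moore_penrose (map_mat (\<phi> i) X) (Q i)" for i
    by metis
  have "\<forall>r c. \<exists>x. \<forall>i. \<phi> i x = Q i $$ (r, c)"
    by (intro allI joint_surj)
  then obtain g where g: "\<phi> i (g r c) = Q i $$ (r, c)" for i r c
    by metis
  define P where "P = mat (dim_col X) (dim_row X) (\<lambda>(r, c). g r c)"
  have "map_mat (\<phi> i) P = Q i" for i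
    using Q[of i] by (intro eq_matI) (auto simp: P_def g moore_penrose_def)
  then show "\<exists>P. is_npinv \<alpha> \<beta> n X P"
    using Q by (intro exI[of _ P]) (subst is_npinv_iff, auto simp: P_def)
next
  fix P Q
  assume *: "is_npinv \<alpha> \<beta> n X P" "is_npinv \<alpha> \<beta> n X Q"
  then have c: "P \<in> carrier_mat (dim_col X) (dim_row X)" "Q \<in> carrier_mat (dim_col X) (dim_row X)"
    by (auto simp: is_npinv_def)
  show "P = Q"
    using * c by (subst mat_eq_iff) (auto simp: is_npinv_iff intro: moore_penrose_unique)
qed

text \<open>U, V and Q are constrained only through their projections, so the different
  constructions for the two signs of alpha both fit.\<close>

lemma npinv_svd:
  assumes svd: "\<And>i. is_svd (map_mat (\<phi> i) X) (Us i) (Ss i) (Vs i)"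
    and U: "\<And>i. map_mat (\<phi> i) U = Us i" and V: "\<And>i. map_mat (\<phi> i) V = Vs i"
    and Q: "\<And>i. map_mat (\<phi> i) Q = map_mat of_real (mp_inverse (Ss i))"
  shows "is_npinv \<alpha> \<beta> n X
    (tess_mat_mult \<alpha> \<beta> (tess_mat_mult \<alpha> \<beta> V Q) (herm (3 - 2 * int n) U))"
proof -
  \<comment> \<open>The dimensions are the same at all indices; an arbitrary one serves to read them
    off.\<close>
  fix i0 :: 'i
  have S: "mp_inverse (Ss i) \<in> carrier_mat (dim_col X) (dim_row X)" for i
    using moore_penrose_mp_inverse[of "Ss i"] svd[of i]
    unfolding moore_penrose_def is_svd_def by auto
  have "dim_row U = dim_row (Us i0)" "dim_col U = dim_col (Us i0)"
    "dim_row V = dim_row (Vs i0)" "dim_col V = dim_col (Vs i0)"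
    "dim_row Q = dim_row (mp_inverse (Ss i0))" "dim_col Q = dim_col (mp_inverse (Ss i0))"
    using arg_cong[OF U[of i0], of dim_row] arg_cong[OF U[of i0], of dim_col]
      arg_cong[OF V[of i0], of dim_row] arg_cong[OF V[of i0], of dim_col]
      arg_cong[OF Q[of i0], of dim_row] arg_cong[OF Q[of i0], of dim_col] by simp_all
  then have d: "dim_row U = dim_row X" "dim_col U = dim_row X"
    "dim_row V = dim_col X" "dim_col V = dim_col X"
    "dim_row Q = dim_col X" "dim_col Q = dim_row X"
    using svd[of i0] S[of i0] unfolding is_svd_def by auto
  let ?P = "tess_mat_mult \<alpha> \<beta> (tess_mat_mult \<alpha> \<beta> V Q) (herm (3 - 2 * int n) U)"
  have c: "?P \<in> carrier_mat (dim_col X) (dim_row X)"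
    using d by (auto simp: tess_mat_mult_def herm_def)
  have "map_mat (\<phi> i) ?P = Vs i * map_mat of_real (mp_inverse (Ss i)) * mat_adjoint (Us i)" for i
  proof -
    have "map_mat (\<phi> i) ?P =
        map_mat (\<phi> i) V * map_mat (\<phi> i) Q * map_mat (\<phi> i) (herm (3 - 2 * int n) U)"
      using d by (subst map_tess_mat_mult, simp add: tess_mat_mult_def herm_def)
        (simp add: map_tess_mat_mult)
    then show ?thesis
      by (simp only: hom_herm U V Q)
  qed
  then show ?thesis
    using moore_penrose_svd[OF svd conjugate_of_real] by (simp add: is_npinv_iff[OF c])
qed

end

section \<open>The two concrete splittings\<close>

lemmas tess_simps = tess_mult_def tess_w1_def tess_w2_def tess_s_def tess_d_def tess_i_def tess_j_def
  tess_of_real_def plus_tess_def minus_tess_def scaleR_tess_def zero_tess_def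

definition split_cpx :: "real \<Rightarrow> real \<Rightarrow> bool \<Rightarrow> tess \<Rightarrow> complex" where
  "split_cpx \<alpha> \<beta> b x = to_cpx \<alpha> (if b then tess_s \<beta> x else tess_d \<beta> x)"

definition split_real :: "real \<Rightarrow> real \<Rightarrow> bool \<times> bool \<Rightarrow> tess \<Rightarrow> real" where
  "split_real \<alpha> \<beta> b x =
     (if snd b then real_s \<alpha> else real_d \<alpha>) (if fst b then tess_s \<beta> x else tess_d \<beta> x)"

text \<open>As w_1 and w_2 are complementary idempotents, the s and d parts split the algebra into
  two copies of C_alpha, each isomorphic to the complex numbers. For n = 2 the subscript is -1, and
  negating the i and k parts conjugates both components.\<close>

lemma tess_splitting_cpx:
  assumes "\<alpha> < 0" "\<beta> > 0"
  shows "tess_splitting \<alpha> \<beta> 2 (split_cpx \<alpha> \<beta>)"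
proof -
  \<comment> \<open>With square roots as parameters, the homomorphism laws become polynomial
    identities in a and b.\<close>
  obtain a where a: "a > 0" "\<alpha> = - (a * a)"
    using assms by (intro that[of "sqrt (- \<alpha>)"]) auto
  obtain b where b: "b > 0" "\<beta> = b * b"
    using assms by (intro that[of "sqrt \<beta>"]) auto
  have [simp]: "sqrt \<bar>\<alpha>\<bar> = a" "sqrt \<beta> = b"
    using a b by (auto simp: abs_mult)
  show ?thesis
  proof
    fix x y :: tess
    assume eq: "split_cpx \<alpha> \<beta> i x = split_cpx \<alpha> \<beta> i y" for i
    have e: "t_re x + b * t_j x = t_re y + b * t_j y" "t_re x - b * t_j x = t_re y - b * t_j y"
      "t_i x + b * t_k x = t_i y + b * t_k y" "t_i x - b * t_k x = t_i y - b * t_k y"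
      using a(1) eq[of True] eq[of False]
      by (simp_all add: split_cpx_def to_cpx_def tess_simps)
    have "t_re x = t_re y" "t_i x = t_i y" "b * t_j x = b * t_j y" "b * t_k x = b * t_k y"
      using e by linarith+
    then show "x = y"
      using b(1) by (cases x; cases y) auto
  next
    fix f :: "bool \<Rightarrow> complex"
    let ?s = "f True" and ?d = "f False"
    \<comment> \<open>The half sum and half difference of the components, with the i parts rescaled
      by a and the j parts by b.\<close>
    let ?x = "Tess ((Re ?s + Re ?d) / 2) ((Im ?s + Im ?d) / (2 * a))
      ((Re ?s - Re ?d) / (2 * b)) ((Im ?s - Im ?d) / (2 * a * b))"
    have "split_cpx \<alpha> \<beta> i ?x = f i" for i
      using a(1) b(1)
      by (cases i) (auto simp: split_cpx_def to_cpx_def tess_simps complex_eq_iff field_simps)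
    then show "\<exists>x. \<forall>i. split_cpx \<alpha> \<beta> i x = f i"
      by blast
  qed (use a(1) b(1) in \<open>auto simp: split_cpx_def to_cpx_def tess_simps complex_eq_iff algebra_simps a(2) b(2)
      herm_def mat_adjoint_conv tess_cnj_i_def\<close>)
qed

text \<open>For alpha > 0 each copy of C_alpha splits again, by sending i to plus or minus the
  square root of alpha. For n = 1 the subscript is 1: the plain transpose is the adjoint over the
  reals.\<close>

lemma tess_splitting_real:
  assumes "\<alpha> > 0" "\<beta> > 0"
  shows "tess_splitting \<alpha> \<beta> 1 (split_real \<alpha> \<beta>)"
proof -
  obtain a where a: "a > 0" "\<alpha> = a * a"
    using assms by (intro that[of "sqrt \<alpha>"]) auto
  obtain b where b: "b > 0" "\<beta> = b * b"
    using assms by (intro that[of "sqrt \<beta>"]) auto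
  have [simp]: "sqrt \<alpha> = a" "sqrt \<beta> = b"
    using a b by auto
  show ?thesis
  proof
    fix x y :: tess
    assume eq: "split_real \<alpha> \<beta> i x = split_real \<alpha> \<beta> i y" for i
    have e: "t_re x + b * t_j x + a * (t_i x + b * t_k x) = t_re y + b * t_j y + a * (t_i y + b * t_k y)"
      "t_re x + b * t_j x - a * (t_i x + b * t_k x) = t_re y + b * t_j y - a * (t_i y + b * t_k y)"
      "t_re x - b * t_j x + a * (t_i x - b * t_k x) = t_re y - b * t_j y + a * (t_i y - b * t_k y)"
      "t_re x - b * t_j x - a * (t_i x - b * t_k x) = t_re y - b * t_j y - a * (t_i y - b * t_k y)"
      using eq[of "(True, True)"] eq[of "(True, False)"] eq[of "(False, True)"] eq[of "(False, False)"]
      by (simp_all add: split_real_def real_s_def real_d_def tess_simps)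
    \<comment> \<open>Half the difference of the two equations for the same idempotent; cancelling a
      leaves linear equations.\<close>
    have "a * (t_i x + b * t_k x) = a * (t_i y + b * t_k y)"
      "a * (t_i x - b * t_k x) = a * (t_i y - b * t_k y)"
      using e by linarith+
    then have i: "t_i x + b * t_k x = t_i y + b * t_k y" "t_i x - b * t_k x = t_i y - b * t_k y"
      using a(1) by simp_all
    have "t_re x = t_re y" "t_i x = t_i y" "b * t_j x = b * t_j y" "b * t_k x = b * t_k y"
      using e i by linarith+
    then show "x = y"
      using a(1) b(1) by (cases x; cases y) auto
  next
    fix f :: "bool \<times> bool \<Rightarrow> real"
    let ?s1 = "f (True, True)" and ?d1 = "f (True, False)"
    let ?s2 = "f (False, True)" and ?d2 = "f (False, False)"
    \<comment> \<open>The signs form a 4 by 4 Hadamard matrix, which inverts the four projections up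
      to the factor 4 and the scalings by a and b.\<close>
    let ?x = "Tess ((?s1 + ?d1 + ?s2 + ?d2) / 4) ((?s1 - ?d1 + ?s2 - ?d2) / (4 * a))
      ((?s1 + ?d1 - ?s2 - ?d2) / (4 * b)) ((?s1 - ?d1 - ?s2 + ?d2) / (4 * a * b))"
    have "split_real \<alpha> \<beta> i ?x = f i" for i
      using a(1) b(1)
      by (cases i; cases "fst i"; cases "snd i")
        (auto simp: split_real_def real_s_def real_d_def tess_simps field_simps)
    then show "\<exists>x. \<forall>i. split_real \<alpha> \<beta> i x = f i"
      by blast
  qed (use a(1) b(1) in \<open>auto simp: split_real_def real_s_def real_d_def tess_simps algebra_simps a(2) b(2)
      herm_def mat_adjoint_conv\<close>)
qed

section \<open>Projections of the assembled factors\<close>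

lemma join_i_dim:
  "dim_row (join_i \<alpha> Y Z) = dim_row Z" "dim_col (join_i \<alpha> Y Z) = dim_col Z"
  by (simp_all add: join_i_def)

lemma is_svd_dim:
  assumes "is_svd A U S V"
  shows "dim_row U = dim_row A" "dim_col U = dim_row A" "dim_row V = dim_col A" "dim_col V = dim_col A"
    "dim_row (mp_inverse S) = dim_col A" "dim_col (mp_inverse S) = dim_row A"
proof -
  show "dim_row U = dim_row A" "dim_col U = dim_row A" "dim_row V = dim_col A" "dim_col V = dim_col A"
    using assms by (simp_all only: is_svd_def carrier_mat_def mem_Collect_eq)
  have "dim_row S = dim_row A" "dim_col S = dim_col A"
    using assms by (simp_all only: is_svd_def carrier_mat_def mem_Collect_eq)
  then show "dim_row (mp_inverse S) = dim_col A" "dim_col (mp_inverse S) = dim_row A"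
    using moore_penrose_mp_inverse[of S] by (auto simp: moore_penrose_def)
qed

text \<open>Matrices over C_alpha: the s and d parts of y w_1 + z w_2 lie in C_alpha, so they return
  y and z only if these lie there too.\<close>

definition C_mat :: "tess mat \<Rightarrow> bool" where
  "C_mat Y \<longleftrightarrow> (\<forall>i<dim_row Y. \<forall>j<dim_col Y. t_j (Y $$ (i, j)) = 0 \<and> t_k (Y $$ (i, j)) = 0)"

text \<open>The element x is y w_1 + z w_2 with the idempotents expanded.\<close>

lemma tess_s_d_combine_j:
  fixes \<alpha> \<beta> :: real
  assumes "\<beta> > 0" "t_j y = 0" "t_k y = 0" "t_j z = 0" "t_k z = 0"
  defines "x \<equiv> (1 / 2) *\<^sub>R (y + z) + tess_mult \<alpha> \<beta> ((1 / (2 * sqrt \<beta>)) *\<^sub>R (y - z)) tess_j"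
  shows "tess_s \<beta> x = y" "tess_d \<beta> x = z"
  using assms(1-5) unfolding x_def by (cases y; cases z; simp add: tess_simps field_simps)+

lemma tess_s_d_combine_w:
  fixes \<alpha> \<beta> :: real
  assumes "\<beta> > 0" "t_j y = 0" "t_k y = 0" "t_j z = 0" "t_k z = 0"
  defines "x \<equiv> tess_mult \<alpha> \<beta> y (tess_w1 \<beta>) + tess_mult \<alpha> \<beta> z (tess_w2 \<beta>)"
  shows "tess_s \<beta> x = y" "tess_d \<beta> x = z"
  using assms(1-5) unfolding x_def by (cases y; cases z; simp add: tess_simps field_simps)+

lemma map_tess_s_d_join:
  assumes "\<beta> > 0" "C_mat Y" "C_mat Z" "dim_row Z = dim_row Y" "dim_col Z = dim_col Y"
  shows "map_mat (tess_s \<beta>) (join_j \<alpha> \<beta> Y Z) = Y" "map_mat (tess_d \<beta>) (join_j \<alpha> \<beta> Y Z) = Z"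
    "map_mat (tess_s \<beta>) (join_w \<alpha> \<beta> Y Z) = Y" "map_mat (tess_d \<beta>) (join_w \<alpha> \<beta> Y Z) = Z"
  using assms
  by (auto intro!: eq_matI tess_s_d_combine_j tess_s_d_combine_w simp: join_j_def join_w_def C_mat_def)

lemma C_mat_simps [simp]:
  "C_mat (map_mat (of_cpx \<alpha>) A)" "C_mat (map_mat tess_of_real B)"
  by (auto simp: C_mat_def of_cpx_def tess_simps)

lemma C_mat_join_i [simp]:
  assumes "dim_row Z = dim_row Y" "dim_col Z = dim_col Y"
  shows "C_mat (join_i \<alpha> Y Z)"
  using assms by (auto simp: C_mat_def join_i_def tess_simps)

lemma map_to_cpx [simp]:
  assumes "\<alpha> \<noteq> 0"
  shows "map_mat (to_cpx \<alpha>) (map_mat (of_cpx \<alpha>) A) = A"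
  using assms by (intro eq_matI) (auto simp: to_cpx_def of_cpx_def tess_simps complex_eq_iff)

lemma map_to_cpx_of_real [simp]:
  "map_mat (to_cpx \<alpha>) (map_mat tess_of_real B) = map_mat of_real B"
  by (intro eq_matI) (auto simp: to_cpx_def tess_simps complex_eq_iff)

lemma map_real_s_d_join_i:
  assumes "\<alpha> > 0" "dim_row Z = dim_row Y" "dim_col Z = dim_col Y"
  shows "map_mat (real_s \<alpha>) (join_i \<alpha> Y Z) = Y" "map_mat (real_d \<alpha>) (join_i \<alpha> Y Z) = Z"
  using assms
  by (auto intro!: eq_matI simp: real_s_def real_d_def join_i_def tess_simps field_simps)

lemma map_split_cpx:
  "map_mat (split_cpx \<alpha> \<beta> i) M =
    map_mat (to_cpx \<alpha>) (map_mat (if i then tess_s \<beta> else tess_d \<beta>) M)"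
  by (intro eq_matI) (auto simp: split_cpx_def)

lemma map_split_real:
  "map_mat (split_real \<alpha> \<beta> i) M =
    map_mat (if snd i then real_s \<alpha> else real_d \<alpha>)
      (map_mat (if fst i then tess_s \<beta> else tess_d \<beta>) M)"
  by (intro eq_matI) (auto simp: split_real_def)

theorem theorem8:
  fixes \<alpha> \<beta> :: real and n p q :: nat and X :: "tess mat"
  assumes "\<alpha> \<noteq> 0" and "\<beta> > 0"
    and "n = (if \<alpha> > 0 then 1 else 2)"
    and "X \<in> carrier_mat p q"
  shows
    "(\<exists>!P. is_npinv \<alpha> \<beta> n X P) \<and>
     (\<alpha> < 0 \<longrightarrow>
       (\<forall>Us Ss Vs Ud Sd Vd.
          is_svd (map_mat (to_cpx \<alpha>) (map_mat (tess_s \<beta>) X)) Us Ss Vs \<and>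
          is_svd (map_mat (to_cpx \<alpha>) (map_mat (tess_d \<beta>) X)) Ud Sd Vd \<longrightarrow>
          (let U = join_j \<alpha> \<beta> (map_mat (of_cpx \<alpha>) Us) (map_mat (of_cpx \<alpha>) Ud);
               V = join_j \<alpha> \<beta> (map_mat (of_cpx \<alpha>) Vs) (map_mat (of_cpx \<alpha>) Vd);
               Ps = map_mat tess_of_real (mp_inverse Ss);
               Pd = map_mat tess_of_real (mp_inverse Sd);
               Q = join_w \<alpha> \<beta> Ps Pd
           in is_npinv \<alpha> \<beta> n X
                (tess_mat_mult \<alpha> \<beta> (tess_mat_mult \<alpha> \<beta> V Q) (herm (3 - 2 * int n) U))))) \<and>
     (\<alpha> > 0 \<longrightarrow>
       (\<forall>Us1 Ss1 Vs1 Ud1 Sd1 Vd1 Us2 Ss2 Vs2 Ud2 Sd2 Vd2.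
          is_svd (map_mat (real_s \<alpha>) (map_mat (tess_s \<beta>) X)) Us1 Ss1 Vs1 \<and>
          is_svd (map_mat (real_d \<alpha>) (map_mat (tess_s \<beta>) X)) Ud1 Sd1 Vd1 \<and>
          is_svd (map_mat (real_s \<alpha>) (map_mat (tess_d \<beta>) X)) Us2 Ss2 Vs2 \<and>
          is_svd (map_mat (real_d \<alpha>) (map_mat (tess_d \<beta>) X)) Ud2 Sd2 Vd2 \<longrightarrow>
          (let U = join_j \<alpha> \<beta> (join_i \<alpha> Us1 Ud1) (join_i \<alpha> Us2 Ud2);
               V = join_j \<alpha> \<beta> (join_i \<alpha> Vs1 Vd1) (join_i \<alpha> Vs2 Vd2);
               Ps = join_i \<alpha> (mp_inverse Ss1) (mp_inverse Sd1);
               Pd = join_i \<alpha> (mp_inverse Ss2) (mp_inverse Sd2);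
               Q = join_w \<alpha> \<beta> Ps Pd
           in is_npinv \<alpha> \<beta> n X
                (tess_mat_mult \<alpha> \<beta> (tess_mat_mult \<alpha> \<beta> V Q) (herm (3 - 2 * int n) U)))))"
proof (intro conjI impI allI, goal_cases)
  case 1
  show ?case
  proof (cases "\<alpha> < 0")
    case True
    then show ?thesis
      using assms tess_splitting.npinv_ex1[OF tess_splitting_cpx] by auto
  next
    case False
    then show ?thesis
      using assms tess_splitting.npinv_ex1[OF tess_splitting_real] by auto
  qed
next
  case (2 Us Ss Vs Ud Sd Vd)
  then have s: "is_svd (map_mat (to_cpx \<alpha>) (map_mat (tess_s \<beta>) X)) Us Ss Vs"
    and d: "is_svd (map_mat (to_cpx \<alpha>) (map_mat (tess_d \<beta>) X)) Ud Sd Vd"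
    by auto
  have n: "n = 2"
    using assms 2 by simp
  interpret tess_splitting \<alpha> \<beta> 2 "split_cpx \<alpha> \<beta>"
    using assms 2 by (intro tess_splitting_cpx) auto
  show ?case
    unfolding Let_def n
    \<comment> \<open>Index \<open>True\<close> stands for the w_1 component and
      \<open>False\<close> for the w_2 component.\<close>
    by (rule npinv_svd[where Us = "\<lambda>i. if i then Us else Ud" and Ss = "\<lambda>i. if i then Ss else Sd"
            and Vs = "\<lambda>i. if i then Vs else Vd"])
      (use s d is_svd_dim[OF s] is_svd_dim[OF d] assms 2 in
        \<open>simp_all add: map_split_cpx map_tess_s_d_join\<close>)
next
  case (3 Us1 Ss1 Vs1 Ud1 Sd1 Vd1 Us2 Ss2 Vs2 Ud2 Sd2 Vd2)
  then have s1: "is_svd (map_mat (real_s \<alpha>) (map_mat (tess_s \<beta>) X)) Us1 Ss1 Vs1"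
    and d1: "is_svd (map_mat (real_d \<alpha>) (map_mat (tess_s \<beta>) X)) Ud1 Sd1 Vd1"
    and s2: "is_svd (map_mat (real_s \<alpha>) (map_mat (tess_d \<beta>) X)) Us2 Ss2 Vs2"
    and d2: "is_svd (map_mat (real_d \<alpha>) (map_mat (tess_d \<beta>) X)) Ud2 Sd2 Vd2"
    by auto
  have n: "n = 1"
    using assms 3 by simp
  \<comment> \<open>Over the reals \<open>of_real\<close> simplifies to \<open>id\<close>.\<close>
  have map_id: "map_mat id M = M" for M :: "real mat"
    by (intro eq_matI) auto
  \<comment> \<open>The first flag chooses between s and d parts with respect to w_1 and w_2, the
    second the sign of the square root of alpha; the order is s1, d1, s2, d2.\<close>
  let ?select = "\<lambda>A B C D i. if fst i then if snd i then A else B else if snd i then C else D"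
  interpret tess_splitting \<alpha> \<beta> 1 "split_real \<alpha> \<beta>"
    using assms 3 by (intro tess_splitting_real) auto
  show ?case
    unfolding Let_def n
    by (rule npinv_svd[where Us = "?select Us1 Ud1 Us2 Ud2" and Ss = "?select Ss1 Sd1 Ss2 Sd2"
            and Vs = "?select Vs1 Vd1 Vs2 Vd2"])
      (use s1 d1 s2 d2 is_svd_dim[OF s1] is_svd_dim[OF d1] is_svd_dim[OF s2] is_svd_dim[OF d2]
          assms 3 in \<open>simp_all add: map_id map_split_real map_tess_s_d_join map_real_s_d_join_i join_i_dim\<close>)
qed

end
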